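(* Let $(X,\mathcal{F},\mu)$ be a measure space with atomless, $\sigma$-finite, non-zero measure $\mu$, and let $N$ be a Young-Orlicz function. Assume that $$J(N)=\inf_{C>0}\int_0^\infty N(Ct)\,|dV_N(t)|<\infty .$$ Let $k_0[N]=Q^{-1}(1)\in[1,\infty)$, i.e. $k_0[N]$ is the value of $k$ at which $Q(k)=1$, where $$Q(k)=\int_{y_0}^\infty N(y/k)\,\left|d\frac1{N(y)}\right|,\qquad k\in(1,\infty],\qquad y_0=N^{-1}(1/\mu(X)).$$ Then for every $f\in wL(N)$ $$\|f\|_{sL(N)}\le k_0[N]\,\|f\|_{wL(N)},$$ and the coefficient $k_0[N]$ is the best possible; namely, $$Y(N)=\sup_{0\ne f\in wL(N)}\frac{\|f\|_{sL(N)}}{\|f\|_{wL(N)}}=k_0[N].$$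
   Context: A Young-Orlicz function is a function $N:\mathbb{R}\to[0,\infty)$ that is even, continuous, convex, strictly increasing to infinity on $[0,\infty)$, with $\lim_{u\to0}N(u)/u=0$ and $\lim_{u\to\infty}N(u)/u=+\infty$; in particular $N(u)=0$ iff $u=0$. $N^{-1}$ denotes the inverse of $N$ restricted to $[0,\infty)$; $1/\mu(X)=0$ if $\mu(X)=\infty$ (so then $y_0=0$). $M_0(X,\mu)$ is the set of all measurable functions $f:X\to\mathbb{R}$ finite almost everywhere (functions equal a.e. are identified, so $f\ne0$ means $f$ is not a.e. zero). For $f\in M_0(X,\mu)$ the tail function is $T[f](t)=\mu\{x:|f(x)|\ge t\}$, $t\ge0$. Strong (Luxemburg) norm: $\|f\|_{sL(N)}=\inf\{k>0:\int_X N(|f(x)|/k)\,d\mu(x)\le1\}$, with value $+\infty$ if no such $k$ exists. $V_N(t)=\min\left(\mu(X),\frac1{N(t)}\right)$, $t\ge0$, with the conventions $1/N(0)=\infty$ and $\min(c,\infty)=c$ (the measure $\mu(X)$ may be infinite). Weak norm: $\|f\|_{wL(N)}=\inf\{K>0:\ T[f](t)\le V_N(t/K)\ \text{for all } t>0\}$, with value $+\infty$ if no such $K$ exists. The weak Orlicz space $wL(N)$ is the set of $f\in M_0(X,\mu)$ with $\|f\|_{wL(N)}<\infty$. $V_N$ and $1/N$ are non-increasing on $(0,\infty)$; $|dV_N(t)|=-dV_N(t)$ and $\left|d\frac1{N(y)}\right|=-d\frac1{N(y)}$ denote the associated positive Lebesgue-Stieltjes measures. The function $Q$ takes values in $[0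,\infty]$.
   Formalization: The existence of a k in [1,∞) with Q(k)=1 is taken as a hypothesis: it does not follow from J(N)<∞, since Q can jump from ∞ to a value below 1, in which case k_0[N]=Q^{-1}(1) is undefined. *)

theory Defs
  imports "HOL-Analysis.Analysis"
begin

definition young_orlicz :: "(real \<Rightarrow> real) \<Rightarrow> bool" where
  "young_orlicz N \<longleftrightarrow>
     (\<forall>u. 0 \<le> N u) \<and> (\<forall>u. N (- u) = N u) \<and>
     continuous_on UNIV N \<and> convex_on UNIV N \<and>
     strict_mono_on {0..} N \<and> filterlim N at_top at_top \<and>
     ((\<lambda>u. N u / u) \<longlongrightarrow> 0) (at 0) \<and>
     filterlim (\<lambda>u. N u / u) at_top at_top"

definition atomless :: "'a measure \<Rightarrow> bool" where
  "atomless M \<longleftrightarrow>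
     (\<forall>A\<in>sets M. 0 < emeasure M A \<longrightarrow>
        (\<exists>B\<in>sets M. B \<subseteq> A \<and> 0 < emeasure M B \<and> emeasure M B < emeasure M A))"

definition tail :: "'a measure \<Rightarrow> ('a \<Rightarrow> real) \<Rightarrow> real \<Rightarrow> ennreal" where
  "tail M f t = emeasure M {x \<in> space M. t \<le> \<bar>f x\<bar>}"

text \<open>The infimum of the empty set in \<^typ>\<open>ennreal\<close> is \<^term>\<open>\<infinity> :: ennreal\<close>.\<close>

definition strong_norm :: "'a measure \<Rightarrow> (real \<Rightarrow> real) \<Rightarrow> ('a \<Rightarrow> real) \<Rightarrow> ennreal" where
  "strong_norm M N f =
     Inf {ennreal k | k. 0 < k \<and> (\<integral>\<^sup>+ x. ennreal (N (\<bar>f x\<bar> / k)) \<partial>M) \<le> 1}"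

text \<open>In \<^typ>\<open>ennreal\<close>, \<open>1 / 0 = \<infinity>\<close> and \<open>1 / \<infinity> = 0\<close>.\<close>

definition recip :: "(real \<Rightarrow> real) \<Rightarrow> real \<Rightarrow> ennreal" where
  "recip N t = 1 / ennreal (N t)"

definition V :: "'a measure \<Rightarrow> (real \<Rightarrow> real) \<Rightarrow> real \<Rightarrow> ennreal" where
  "V M N t = min (emeasure M (space M)) (recip N t)"

definition weak_norm :: "'a measure \<Rightarrow> (real \<Rightarrow> real) \<Rightarrow> ('a \<Rightarrow> real) \<Rightarrow> ennreal" where
  "weak_norm M N f =
     Inf {ennreal K | K. 0 < K \<and> (\<forall>t>0. tail M f t \<le> V M N (t / K))}"

text \<open>Real-valued functions suffice: functions that are finite almost everywhere are
  considered up to equality almost everywhere.\<close>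

definition weak_orlicz :: "'a measure \<Rightarrow> (real \<Rightarrow> real) \<Rightarrow> ('a \<Rightarrow> real) set" where
  "weak_orlicz M N = {f \<in> borel_measurable M. weak_norm M N f < \<infinity>}"

text \<open>The positive Lebesgue-Stieltjes measure \<open>-dg\<close> on the open half-line \<open>(0, \<infinity>)\<close>, for \<open>g\<close>
  non-increasing, right-continuous and finite there.  The library's \<^const>\<open>interval_measure\<close>
  needs an integrator that is finite on the whole line, whereas \<open>1 / N\<close> is infinite at \<open>0\<close>.\<close>

definition stieltjes :: "(real \<Rightarrow> ennreal) \<Rightarrow> real measure" where
  "stieltjes g =
     extend_measure {0<..} {(a, b). 0 < a \<and> a \<le> b} (\<lambda>(a, b). {a<..b}) (\<lambda>(a, b). g a - g b)"

definition J :: "'a measure \<Rightarrow> (real \<Rightarrow> real) \<Rightarrow> ennreal" where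
  "J M N = (INF C\<in>{0<..}. \<integral>\<^sup>+ t. ennreal (N (C * t)) \<partial>stieltjes (V M N))"

definition y0 :: "'a measure \<Rightarrow> (real \<Rightarrow> real) \<Rightarrow> real" where
  "y0 M N = inv_into {0..} N (enn2real (1 / emeasure M (space M)))"

definition Q :: "'a measure \<Rightarrow> (real \<Rightarrow> real) \<Rightarrow> real \<Rightarrow> ennreal" where
  "Q M N k = (\<integral>\<^sup>+ y\<in>{y0 M N<..}. ennreal (N (y / k)) \<partial>stieltjes (recip N))"

definition Y :: "'a measure \<Rightarrow> (real \<Rightarrow> real) \<Rightarrow> ennreal" where
  "Y M N = (SUP f\<in>{f \<in> weak_orlicz M N. \<not> (AE x in M. f x = 0)}.
              strong_norm M N f / weak_norm M N f)"

end

theory Submission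
  imports Defs
begin

text \<open>Both norms depend on a function only through its tail, and the theorem is a comparison of tails.
The layer-cake formula writes the modular \<open>\<integral> N(|f|/c) d\<mu>\<close> as \<open>\<integral>\<^sub>0\<^sup>\<infinity> T[f](c N\<inverse>(u)) du\<close>
(\<open>modular_eq_integral_tail\<close>). The same formula, applied after the substitution \<open>y = N\<inverse>(1/s)\<close> that turns
\<open>-d(1/N)\<close> into Lebesgue measure (\<open>stieltjes_recip_eq_distr\<close>), gives
\<open>Q(k) = \<integral>\<^sub>0\<^sup>\<infinity> V\<^sub>N(k N\<inverse>(u)) du\<close> (\<open>Q_eq_integral_V\<close>). If \<open>T[f](t) \<le> V\<^sub>N(t/K)\<close> for all \<open>t > 0\<close>, the modular
of \<open>f\<close> at scale \<open>k\<^sub>0 K\<close> is thus at most \<open>Q(k\<^sub>0) = 1\<close>, and taking the infimum over \<open>K\<close> yields the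
inequality between the norms (\<open>strong_norm_le_weak_norm\<close>).

For sharpness it suffices to have a function whose tail is exactly \<open>V\<^sub>N\<close>. Its weak norm is at most \<open>1\<close>
and its modular at scale \<open>k\<close> is \<open>Q(k)\<close>, which exceeds \<open>1\<close> for \<open>k < k\<^sub>0\<close> by convexity of \<open>N\<close>
(\<open>Q_contraction\<close>), so its strong norm is at least \<open>k\<^sub>0\<close>. Such a function is \<open>N\<inverse>(1/U)\<close>
(\<open>tail_extremal_exists\<close>), where \<open>U\<close> transports \<open>\<mu>\<close> to Lebesgue measure on \<open>(0, \<mu>(X))\<close>. This is where
atomlessness enters: by Sierpinski's theorem (\<open>atomless_subset_of_measure\<close>) the space has nested sets of
all dyadic measures up to \<open>\<mu>(X)\<close>, and \<open>U\<close> is read off from them (\<open>atomless_uniform_function\<close>).\<close>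

section \<open>Atomless measures and uniform functions\<close>

text \<open>Atomlessness first yields a subset of finite positive measure, even when \<open>A\<close> has infinite measure.
Splitting that set into two parts of positive measure, one of them has at most half of its measure,
so repeated splitting reaches arbitrarily small sets.\<close>
lemma atomless_small_subset:
  fixes e :: real
  assumes "atomless M" and A: "A \<in> sets M" "0 < emeasure M A" and e: "0 < e"
  shows "\<exists>B\<in>sets M. B \<subseteq> A \<and> 0 < emeasure M B \<and> emeasure M B \<le> ennreal e"
proof -
  obtain B0 where B0: "B0 \<in> sets M" "B0 \<subseteq> A" "0 < emeasure M B0" "emeasure M B0 < emeasure M A"
    using assms unfolding atomless_def by metis
  then have "emeasure M B0 < \<infinity>" by (metis order.strict_trans2 infinity_ennreal_def top_greatest)
  then obtain b where b: "emeasure M B0 = ennreal b" "0 \<le> b"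
    by (cases "emeasure M B0") auto
  have "\<exists>B\<in>sets M. B \<subseteq> A \<and> 0 < emeasure M B \<and> emeasure M B \<le> ennreal (b / 2 ^ n)" for n
  proof (induction n)
    case 0
    then show ?case using B0 b by auto
  next
    case (Suc n)
    then obtain B where B: "B \<in> sets M" "B \<subseteq> A" "0 < emeasure M B"
      "emeasure M B \<le> ennreal (b / 2 ^ n)" by auto
    obtain C where C: "C \<in> sets M" "C \<subseteq> B" "0 < emeasure M C" "emeasure M C < emeasure M B"
      using assms B unfolding atomless_def by metis
    have fB: "emeasure M B \<noteq> \<infinity>" using B(4) neq_top_trans by force
    then have fC: "emeasure M C \<noteq> \<infinity>" using C(4) by auto
    have D: "emeasure M (B - C) = ennreal (measure M B - measure M C)"
      using fB fC B C emeasure_Diff[of M C B]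
      by (simp add: emeasure_eq_ennreal_measure ennreal_minus)
    have lt: "measure M C < measure M B" "0 < measure M C" "measure M B \<le> b / 2 ^ n"
      using fB fC B C b(2) by (auto simp: emeasure_eq_ennreal_measure ennreal_less_iff)
    show ?case
    proof (cases "measure M C \<le> measure M B / 2")
      case True
      with lt have "emeasure M C \<le> ennreal (b / 2 ^ Suc n)"
        using fC by (auto simp: emeasure_eq_ennreal_measure intro!: ennreal_leI)
      with B C show ?thesis by blast
    next
      case False
      with lt have "emeasure M (B - C) \<le> ennreal (b / 2 ^ Suc n)" "0 < emeasure M (B - C)"
        unfolding D by (auto intro!: ennreal_leI)
      with B C show ?thesis by (intro bexI[of _ "B - C"]) auto
    qed
  qed
  moreover obtain n where "b / 2 ^ n \<le> e"
  proof -
    obtain n :: nat where "b / e < real n" using reals_Archimedean2 by blast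
    also have "real n \<le> 2 ^ n" using of_nat_less_two_power[of n] by (simp add: less_imp_le)
    finally have "b / 2 ^ n \<le> e" using e by (simp add: field_simps)
    then show ?thesis by (rule that)
  qed
  then have "ennreal (b / 2 ^ n) \<le> ennreal e" by (rule ennreal_leI)
  ultimately show ?thesis by (meson order_trans)
qed

text \<open>Sierpinski's theorem on the range of an atomless measure. A greedy exhaustion avoids transfinite
arguments: each step adjoins a set \<open>C\<close> that still fits below the level \<open>c\<close> and has at least half of the
supremum of the measures possible. If the union stayed below \<open>c\<close>, some small set of positive measure would
fit into the remaining gap at every step; each step would then gain at least half of that measure,
and the measures would exceed \<open>c\<close>.\<close>
theorem atomless_subset_of_measure:
  fixes c :: real
  assumes at: "atomless M" and A: "A \<in> sets M" "ennreal c \<le> emeasure M A" and c: "0 \<le> c"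
  shows "\<exists>B\<in>sets M. B \<subseteq> A \<and> emeasure M B = ennreal c"
proof -
  define P where "P B \<longleftrightarrow> B \<in> sets M \<and> B \<subseteq> A \<and> emeasure M B \<le> ennreal c" for B
  define R where "R B B' \<longleftrightarrow> B \<subseteq> B' \<and>
    (\<forall>C\<in>sets M. C \<subseteq> A - B \<and> emeasure M B + emeasure M C \<le> ennreal c \<longrightarrow>
      measure M C / 2 \<le> measure M B' - measure M B)" for B B'
  have "\<exists>B'. P B' \<and> R B B'" if B: "P B" for B
  proof -
    \<comment> \<open>The candidates for the next step; their measures are bounded by \<open>c\<close>, so the supremum exists
      even though \<open>M\<close> may be infinite.\<close>
    define X where "X = {C \<in> sets M. C \<subseteq> A - B \<and> emeasure M B + emeasure M C \<le> ennreal c}"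
    have fin: "emeasure M C \<le> ennreal c" if "C \<in> X" for C
    proof -
      have "emeasure M C \<le> emeasure M B + emeasure M C" by (simp add: add_increasing)
      also have "\<dots> \<le> ennreal c" using that by (simp add: X_def)
      finally show ?thesis .
    qed
    have "measure M C \<le> c" if "C \<in> X" for C
      unfolding measure_def using enn2real_mono[OF fin[OF that]] c by simp
    then have bdd: "bdd_above (measure M ` X)" by (rule bdd_aboveI2)
    have "{} \<in> X" using B by (auto simp: X_def P_def)
    then have S0: "0 \<le> (SUP C\<in>X. measure M C)"
      using cSUP_upper[OF _ bdd, of "{}"] by simp
    obtain C where C: "C \<in> X" "(SUP C\<in>X. measure M C) / 2 \<le> measure M C"
    proof (cases "(SUP C\<in>X. measure M C) = 0")
      case True
      then show ?thesis using \<open>{} \<in> X\<close> by (intro that[of "{}"]) auto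
    next
      case False
      with S0 have "(SUP C\<in>X. measure M C) / 2 < (SUP C\<in>X. measure M C)" by simp
      then obtain C where "C \<in> X" "(SUP C\<in>X. measure M C) / 2 < measure M C"
        using less_cSUP_iff[OF _ bdd, THEN iffD1] \<open>{} \<in> X\<close> by (metis empty_iff)
      then show ?thesis by (intro that[of C]) auto
    qed
    have Cs: "C \<in> sets M" "C \<subseteq> A - B" "emeasure M B + emeasure M C \<le> ennreal c"
      using C by (auto simp: X_def)
    have Bs: "B \<in> sets M" "B \<subseteq> A" "emeasure M B \<le> ennreal c" using B by (auto simp: P_def)
    have "emeasure M (B \<union> C) = emeasure M B + emeasure M C"
      using Cs Bs by (intro plus_emeasure[symmetric]) auto
    then have "P (B \<union> C)" using Cs Bs by (auto simp: P_def)
    moreover have "measure M (B \<union> C) = measure M B + measure M C"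
      using Cs Bs fin[OF C(1)] by (intro measure_Union) (auto simp: top_unique)
    then have "R B (B \<union> C)"
      using C(2) cSUP_upper[OF _ bdd] by (fastforce simp: R_def X_def)
    ultimately show ?thesis by blast
  qed
  moreover have "P {}" by (simp add: P_def)
  ultimately obtain F where F: "\<And>n. P (F n)" "\<And>n. R (F n) (F (Suc n))"
    using dependent_nat_choice[of "\<lambda>_. P" "\<lambda>_. R"] by metis
  have Fs: "F n \<in> sets M" "F n \<subseteq> A" "emeasure M (F n) \<le> ennreal c" for n
    using F(1) by (auto simp: P_def)
  have inc: "incseq F" using F(2) by (intro incseq_SucI) (auto simp: R_def)
  let ?B = "\<Union>n. F n"
  have Bs: "?B \<in> sets M" "?B \<subseteq> A" using Fs by auto
  have Bc: "emeasure M ?B \<le> ennreal c"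
  proof -
    have "(SUP n. emeasure M (F n)) = emeasure M ?B"
      by (rule SUP_emeasure_incseq[OF _ inc]) (use Fs in blast)
    moreover have "(SUP n. emeasure M (F n)) \<le> ennreal c" by (rule SUP_least) (rule Fs)
    ultimately show ?thesis by simp
  qed
  have "\<not> emeasure M ?B < ennreal c"
  proof
    assume lt: "emeasure M ?B < ennreal c"
    then obtain b where b: "emeasure M ?B = ennreal b" "0 \<le> b"
      by (cases "emeasure M ?B") auto
    with lt have "b < c" by (simp add: ennreal_less_iff)
    have "emeasure M (A - ?B) = emeasure M A - emeasure M ?B"
      using Bs A b by (intro emeasure_Diff) auto
    also have "\<dots> > 0"
      using lt A(2) b by (simp add: diff_gr0_ennreal less_le_trans)
    finally obtain D where D: "D \<in> sets M" "D \<subseteq> A - ?B" "0 < emeasure M D"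
        "emeasure M D \<le> ennreal (c - b)"
      using atomless_small_subset[OF at, of "A - ?B" "c - b"] Bs A \<open>b < c\<close> by auto
    have dpos: "0 < measure M D"
    proof -
      have "emeasure M D \<noteq> \<infinity>" using D(4) neq_top_trans by force
      then show ?thesis using D(3) by (simp add: emeasure_eq_ennreal_measure)
    qed
    have step: "measure M D / 2 \<le> measure M (F (Suc n)) - measure M (F n)" for n
    proof -
      have "emeasure M (F n) + emeasure M D \<le> ennreal b + ennreal (c - b)"
        using D(4) b emeasure_mono[of "F n" ?B M] Bs by (intro add_mono) auto
      also have "\<dots> = ennreal c" using b \<open>b < c\<close> by (simp flip: ennreal_plus)
      finally have "emeasure M (F n) + emeasure M D \<le> ennreal c" .
      moreover have "D \<subseteq> A - F n" using D(2) by blast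
      ultimately show ?thesis using F(2)[of n] D(1) unfolding R_def by blast
    qed
    have lower: "real n * (measure M D / 2) \<le> measure M (F n)" for n
    proof (induction n)
      case (Suc n)
      then show ?case using step[of n] by (simp add: algebra_simps)
    qed simp
    have upper: "measure M (F n) \<le> c" for n
      unfolding measure_def using enn2real_mono[OF Fs(3)] c by simp
    obtain n :: nat where "c / (measure M D / 2) < real n" using reals_Archimedean2 by blast
    then have "c < real n * (measure M D / 2)" using dpos by (simp add: field_simps)
    then show False using lower[of n] upper[of n] by linarith
  qed
  with Bc Bs show ?thesis by (intro bexI[of _ ?B]) auto
qed

lemma atomless_intermediate_set:
  fixes c :: ennreal
  assumes at: "atomless M" and AB: "A \<in> sets M" "B \<in> sets M" "A \<subseteq> B"
    and c: "emeasure M A \<le> c" "c \<le> emeasure M B" "c < \<infinity>"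
  shows "\<exists>C\<in>sets M. A \<subseteq> C \<and> C \<subseteq> B \<and> emeasure M C = c"
proof -
  have fA: "emeasure M A \<noteq> \<infinity>" using c by auto
  obtain d where d: "c - emeasure M A = ennreal d" "0 \<le> d"
    using c by (cases "c - emeasure M A") auto
  have "ennreal d \<le> emeasure M (B - A)"
    using fA AB c by (simp add: d(1)[symmetric] emeasure_Diff ennreal_minus_mono)
  then obtain D where D: "D \<in> sets M" "D \<subseteq> B - A" "emeasure M D = c - emeasure M A"
    using atomless_subset_of_measure[OF at, of "B - A" d] AB d by auto
  have "emeasure M (A \<union> D) = emeasure M A + emeasure M D"
    using D AB by (intro plus_emeasure[symmetric]) auto
  also have "\<dots> = c" using c by (simp add: D(3) add_diff_inverse_ennreal)
  finally show ?thesis using D AB by (intro bexI[of _ "A \<union> D"]) auto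
qed

text \<open>For \<open>d > 0\<close> such a chain is a discrete version of the sublevel sets \<open>{U \<le> i * d}\<close> of a function \<open>U\<close> that
maps \<open>M\<close> to Lebesgue measure on \<open>(0, \<mu>(X))\<close>; the minimum makes the chain stationary once a finite
total mass is used up.\<close>
definition level_chain :: "'a measure \<Rightarrow> real \<Rightarrow> (nat \<Rightarrow> 'a set) \<Rightarrow> bool" where
  "level_chain M d F \<longleftrightarrow> incseq F \<and>
    (\<forall>i. F i \<in> sets M \<and> emeasure M (F i) = min (emeasure M (space M)) (ennreal (real i * d)))"

lemma level_chain_exists:
  assumes "atomless M" "0 \<le> d"
  shows "\<exists>F. level_chain M d F"
proof -
  let ?c = "\<lambda>i. min (emeasure M (space M)) (ennreal (real i * d))"
  let ?P = "\<lambda>i A. A \<in> sets M \<and> emeasure M A = ?c i"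
  have step: "\<exists>B. ?P (Suc i) B \<and> A \<subseteq> B" if A: "?P i A" for i A
  proof -
    have "?c i \<le> ?c (Suc i)"
      using assms(2) by (intro min.mono ennreal_leI mult_right_mono) auto
    moreover have "?c (Suc i) < \<infinity>"
      by (simp add: min_less_iff_disj)
    ultimately have "\<exists>C\<in>sets M. A \<subseteq> C \<and> C \<subseteq> space M \<and> emeasure M C = ?c (Suc i)"
      using A sets.sets_into_space[of A M]
      by (intro atomless_intermediate_set[OF assms(1)]) auto
    then show ?thesis by blast
  qed
  have "\<exists>F. \<forall>i. ?P i (F i) \<and> F i \<subseteq> F (Suc i)"
  proof (rule dependent_nat_choice[of ?P "\<lambda>_. (\<subseteq>)"])
    show "\<exists>A. ?P 0 A" by (rule exI[of _ "{}"]) simp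
  qed (rule step)
  then obtain F where "\<And>i. ?P i (F i)" "\<And>i. F i \<subseteq> F (Suc i)" by blast
  then show ?thesis unfolding level_chain_def by (intro exI[of _ F]) (simp add: incseq_SucI)
qed

text \<open>The sets of the finer chain with odd index are inserted between two neighbours of the coarser one.
Keeping the coarser sets is what makes the chains of all dyadic levels consistent.\<close>
lemma level_chain_refine:
  assumes "atomless M" "0 \<le> d" and F: "level_chain M d F"
  shows "\<exists>G. level_chain M (d / 2) G \<and> (\<forall>i. G (2 * i) = F i)"
proof -
  let ?m = "\<lambda>t. min (emeasure M (space M)) (ennreal t)"
  have m_mono: "?m s \<le> ?m t" if "s \<le> t" for s t
    using that by (intro min.mono ennreal_leI) auto
  have Fs: "F i \<in> sets M" "emeasure M (F i) = ?m (real i * d)" "F i \<subseteq> F (Suc i)" for i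
    using F by (auto simp: level_chain_def incseq_Suc_iff)
  have "\<exists>C\<in>sets M. F i \<subseteq> C \<and> C \<subseteq> F (Suc i) \<and> emeasure M C = ?m (real (2 * i + 1) * (d / 2))" for i
  proof (rule atomless_intermediate_set[OF assms(1)])
    show "emeasure M (F i) \<le> ?m (real (2 * i + 1) * (d / 2))"
      unfolding Fs by (rule m_mono) (use assms(2) in \<open>simp add: field_simps\<close>)
    show "?m (real (2 * i + 1) * (d / 2)) \<le> emeasure M (F (Suc i))"
      unfolding Fs by (rule m_mono) (use assms(2) in \<open>simp add: field_simps\<close>)
  qed (use Fs in \<open>auto simp: min_less_iff_disj\<close>)
  then obtain C where C: "\<And>i. C i \<in> sets M" "\<And>i. F i \<subseteq> C i" "\<And>i. C i \<subseteq> F (Suc i)"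
    "\<And>i. emeasure M (C i) = ?m (real (2 * i + 1) * (d / 2))"
    by metis
  define G where "G j = (if even j then F (j div 2) else C (j div 2))" for j
  have "G j \<in> sets M \<and> G j \<subseteq> G (Suc j) \<and> emeasure M (G j) = ?m (real j * (d / 2))" for j
  proof (cases "even j")
    case True
    then obtain i where "j = 2 * i" by blast
    then show ?thesis using Fs C by (simp add: G_def)
  next
    case False
    then obtain i where "j = 2 * i + 1" by (rule oddE)
    then show ?thesis using Fs C by (simp add: G_def)
  qed
  then have "level_chain M (d / 2) G"
    unfolding level_chain_def by (simp add: incseq_SucI)
  moreover have "G (2 * i) = F i" for i by (simp add: G_def)
  ultimately show ?thesis by blast
qed

lemma dyadic_chains_exist:
  assumes "atomless M"
  shows "\<exists>F. \<forall>n. level_chain M (1 / 2 ^ n) (F n) \<and> (\<forall>i. F (Suc n) (2 * i) = F n i)"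
proof (rule dependent_nat_choice)
  show "\<exists>F. level_chain M (1 / 2 ^ 0) F"
    using level_chain_exists[OF assms, of 1] by simp
next
  fix F n assume "level_chain M (1 / 2 ^ n) F"
  then show "\<exists>G. level_chain M (1 / 2 ^ Suc n) G \<and> (\<forall>i. G (2 * i) = F i)"
    using level_chain_refine[OF assms, of "1 / 2 ^ n" F] by (simp add: mult.commute)
qed

text \<open>An atomless measure space carries a function whose distribution is Lebesgue measure on
\<open>(0, \<mu>(X))\<close>: it assigns to each point the infimum of the dyadic levels at which the point has already
been collected. Points that no level collects get the value \<open>\<infinity>\<close> (the infimum of the empty
set); when \<open>\<mu>(X) = \<infinity>\<close> they may even form a set of infinite measure, which is why the values are
extended reals.\<close>
theorem atomless_uniform_function:
  assumes "atomless M"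
  obtains U :: "'a \<Rightarrow> ennreal" where "U \<in> borel_measurable M"
    "\<And>s. 0 \<le> s \<Longrightarrow> emeasure M {x \<in> space M. U x \<le> ennreal s} = min (emeasure M (space M)) (ennreal s)"
proof -
  let ?m = "\<lambda>t. min (emeasure M (space M)) (ennreal t)"
  obtain F where chain: "\<And>n. level_chain M (1 / 2 ^ n) (F n)"
    and refine: "\<And>n i. F (Suc n) (2 * i) = F n i"
    using dyadic_chains_exist[OF assms] by metis
  have Fs: "F n i \<in> sets M" "emeasure M (F n i) = ?m (real i / 2 ^ n)" for n i
    using chain[of n] by (auto simp: level_chain_def)
  have Fmono: "i \<le> j \<Longrightarrow> F n i \<subseteq> F n j" for n i j
    using chain[of n] by (auto simp: level_chain_def incseq_def)
  define U where "U x = (INF (n, i) \<in> {(n, i). x \<in> F n i}. ennreal (real i / 2 ^ n))" for x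
  \<comment> \<open>The largest index whose level \<open>i / 2 ^ n\<close> lies strictly below \<open>s\<close>.\<close>
  define r where "r s n = nat (\<lceil>s * 2 ^ n\<rceil> - 1)" for s :: real and n :: nat
  have r_iff: "i \<le> r s n \<longleftrightarrow> real i / 2 ^ n < s" if "0 < s" for s n i
  proof -
    have "0 < s * 2 ^ n" using that by simp
    then have "1 \<le> \<lceil>s * 2 ^ n\<rceil>" by linarith
    then have "i \<le> r s n \<longleftrightarrow> int i < \<lceil>s * 2 ^ n\<rceil>"
      unfolding r_def by (subst le_nat_iff) linarith+
    also have "\<dots> \<longleftrightarrow> real i < s * 2 ^ n" by (simp add: less_ceiling_iff)
    finally show ?thesis by (simp add: field_simps)
  qed
  have U_less: "{x \<in> space M. U x < ennreal s} = (\<Union>n. F n (r s n))" if s: "0 < s" for s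
  proof -
    have "U x < ennreal s \<longleftrightarrow> (\<exists>n i. x \<in> F n i \<and> i \<le> r s n)" for x
      unfolding U_def by (auto simp: INF_less_iff ennreal_less_iff r_iff[OF s])
    also have "\<dots> x \<longleftrightarrow> x \<in> (\<Union>n. F n (r s n))" for x
      using Fmono by blast
    finally show ?thesis using sets.sets_into_space[OF Fs(1)] by auto
  qed
  have meas_less: "emeasure M {x \<in> space M. U x < ennreal s} = ?m s" if s: "0 < s" for s
  proof (rule LIMSEQ_unique)
    have "incseq (\<lambda>n. F n (r s n))"
    proof (rule incseq_SucI)
      fix n
      have "real (2 * r s n) / 2 ^ Suc n < s" using r_iff[OF s, of "r s n" n] by simp
      then have "2 * r s n \<le> r s (Suc n)" using r_iff[OF s] by blast
      then show "F n (r s n) \<subseteq> F (Suc n) (r s (Suc n))"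
        using Fmono[of "2 * r s n" "r s (Suc n)" "Suc n"] by (simp add: refine)
    qed
    then show "(\<lambda>n. emeasure M (F n (r s n))) \<longlonglongrightarrow> emeasure M {x \<in> space M. U x < ennreal s}"
      unfolding U_less[OF s] using Fs by (intro Lim_emeasure_incseq) auto
    have "(\<lambda>n. real (r s n) / 2 ^ n) \<longlonglongrightarrow> s"
    proof (rule tendsto_sandwich)
      show "\<forall>\<^sub>F n in sequentially. s - 1 / 2 ^ n \<le> real (r s n) / 2 ^ n"
      proof (intro always_eventually allI)
        fix n
        have "s \<le> real (Suc (r s n)) / 2 ^ n" using r_iff[OF s, of "Suc (r s n)" n] by simp
        also have "\<dots> = real (r s n) / 2 ^ n + 1 / 2 ^ n" by (simp add: add_divide_distrib)
        finally show "s - 1 / 2 ^ n \<le> real (r s n) / 2 ^ n" by simp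
      qed
      show "\<forall>\<^sub>F n in sequentially. real (r s n) / 2 ^ n \<le> s"
        using r_iff[OF s] by (intro always_eventually allI less_imp_le) blast
      have "(\<lambda>n. s - (1 / 2) ^ n) \<longlonglongrightarrow> s - 0"
        by (intro tendsto_diff tendsto_const LIMSEQ_realpow_zero) auto
      then show "(\<lambda>n. s - 1 / 2 ^ n) \<longlonglongrightarrow> s" by (simp add: power_one_over)
    qed simp
    then show "(\<lambda>n. emeasure M (F n (r s n))) \<longlonglongrightarrow> ?m s"
      unfolding Fs by (intro tendsto_min tendsto_const tendsto_ennrealI)
  qed
  have U_meas: "U \<in> borel_measurable M"
  proof (rule borel_measurableI_less)
    fix y :: ennreal
    have "{x \<in> space M. U x < y} = (\<Union>(n, i) \<in> {(n, i). ennreal (real i / 2 ^ n) < y}. F n i)"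
      using sets.sets_into_space[OF Fs(1)] by (auto simp: U_def INF_less_iff)
    also have "\<dots> \<in> sets M"
      using Fs(1) by (intro sets.countable_UN'') auto
    finally show "{x \<in> space M. U x < y} \<in> sets M" .
  qed
  note [measurable] = U_meas
  have "emeasure M {x \<in> space M. U x \<le> ennreal s} = ?m s" if s: "0 \<le> s" for s
  proof (rule antisym)
    show "emeasure M {x \<in> space M. U x \<le> ennreal s} \<le> ?m s"
    proof (rule ennreal_le_epsilon)
      fix e :: real assume e: "0 < e"
      have "emeasure M {x \<in> space M. U x \<le> ennreal s} \<le> emeasure M {x \<in> space M. U x < ennreal (s + e)}"
        using s e by (intro emeasure_mono) (auto simp: ennreal_less_iff elim!: le_less_trans)
      also have "\<dots> = ?m (s + e)" using s e by (intro meas_less) simp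
      also have "\<dots> \<le> ?m s + ennreal e"
        using s e by (auto simp: min_def intro: add_increasing2)
      finally show "emeasure M {x \<in> space M. U x \<le> ennreal s} \<le> ?m s + ennreal e" .
    qed
    show "?m s \<le> emeasure M {x \<in> space M. U x \<le> ennreal s}"
    proof (cases "s = 0")
      case False
      then have "?m s = emeasure M {x \<in> space M. U x < ennreal s}"
        using s by (simp add: meas_less)
      also have "\<dots> \<le> emeasure M {x \<in> space M. U x \<le> ennreal s}"
        by (intro emeasure_mono) auto
      finally show ?thesis .
    qed simp
  qed
  with U_meas show thesis by (rule that)
qed

section \<open>Tails, inverses and the Stieltjes measure of the reciprocal\<close>

text \<open>Fubini's theorem for the region below the graph of \<open>g\<close>. It turns integrals of \<open>N\<close> into integrals of
tail functions, so that a comparison of tails becomes a comparison of integrals.\<close>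
lemma layer_cake:
  fixes g :: "'a \<Rightarrow> real"
  assumes "sigma_finite_measure M" and [measurable]: "g \<in> borel_measurable M"
  shows "(\<integral>\<^sup>+ x. ennreal (g x) \<partial>M) =
    (\<integral>\<^sup>+ u\<in>{0<..}. emeasure M {x \<in> space M. u \<le> g x} \<partial>lborel)"
proof -
  interpret M: sigma_finite_measure M by fact
  interpret pair_sigma_finite M lborel
    by (simp add: M.sigma_finite_measure_axioms pair_sigma_finite.intro sigma_finite_lborel)
  have "ennreal (g x) = (\<integral>\<^sup>+ u. indicator {0<..g x} u \<partial>lborel)" for x
    by (cases "0 \<le> g x") (auto simp: ennreal_neg)
  then have "(\<integral>\<^sup>+ x. ennreal (g x) \<partial>M) = (\<integral>\<^sup>+ x. (\<integral>\<^sup>+ u. indicator {0<..g x} u \<partial>lborel) \<partial>M)"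
    by simp
  also have "\<dots> = (\<integral>\<^sup>+ u. (\<integral>\<^sup>+ x. indicator {0<..g x} u \<partial>M) \<partial>lborel)"
    by (rule Fubini'[symmetric]) (simp add: indicator_def)
  also have "\<dots> = (\<integral>\<^sup>+ u\<in>{0<..}. emeasure M {x \<in> space M. u \<le> g x} \<partial>lborel)"
  proof (rule nn_integral_cong)
    fix u :: real
    have "(\<integral>\<^sup>+ x. indicator {0<..g x} u \<partial>M)
        = (\<integral>\<^sup>+ x. indicator {x \<in> space M. u \<le> g x} x * indicator {0<..} u \<partial>M)"
      by (rule nn_integral_cong) (auto simp: indicator_def)
    then show "(\<integral>\<^sup>+ x. indicator {0<..g x} u \<partial>M)
        = emeasure M {x \<in> space M. u \<le> g x} * indicator {0<..} u"
      by (simp add: nn_integral_multc)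
  qed
  finally show ?thesis .
qed

lemma sets_stieltjes:
  "sets (stieltjes g) = sigma_sets {0<..} ((\<lambda>(a, b). {a<..b}) ` {(a, b). 0 < a \<and> a \<le> b})"
  unfolding stieltjes_def by (rule sets_extend_measure) auto

lemma space_stieltjes: "space (stieltjes g) = {0<..}"
  unfolding stieltjes_def by (rule space_extend_measure) auto

lemma Ioi_eq_UN_Ioc:
  "0 \<le> c \<Longrightarrow> {c<..} = (\<Union>n. {c + 1 / real (Suc n)<..c + 1 / real (Suc n) + real n})"
proof (intro set_eqI iffI)
  fix y assume "y \<in> {c<..}"
  then have y: "0 < y - c" by simp
  obtain m where m: "1 / real (Suc m) < y - c"
    using y nat_approx_posE by blast
  obtain k :: nat where k: "y - c \<le> real k" using real_arch_simple by blast
  define n where "n = max m k"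
  have "1 / real (Suc n) \<le> 1 / real (Suc m)" by (simp add: n_def frac_le)
  moreover have "y \<le> c + 1 / real (Suc n) + real n"
  proof -
    have "real k \<le> real n" "0 \<le> 1 / real (Suc n)" by (simp_all add: n_def)
    with k show ?thesis by linarith
  qed
  ultimately show "y \<in> (\<Union>n. {c + 1 / real (Suc n)<..c + 1 / real (Suc n) + real n})"
    using m by (intro UN_I[of n]) auto
next
  fix y assume "y \<in> (\<Union>n. {c + 1 / real (Suc n)<..c + 1 / real (Suc n) + real n})"
  then obtain n where "c + 1 / real (Suc n) < y" by auto
  moreover have "0 < 1 / real (Suc n)" by simp
  ultimately show "y \<in> {c<..}" unfolding greaterThan_iff by linarith
qed

text \<open>The half-open intervals in \<open>(0, \<infinity>)\<close> generate enough sets for Borel functions on the line to be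
measurable with respect to the Stieltjes measure.\<close>
lemma ident_measurable_stieltjes: "(\<lambda>y. y) \<in> borel_measurable (stieltjes g)"
proof (rule borel_measurableI_greater)
  fix c :: real
  have "{y \<in> space (stieltjes g). c < y} = {max 0 c<..}"
    by (auto simp: space_stieltjes)
  also have "\<dots> \<in> sets (stieltjes g)"
    unfolding sets_stieltjes
  proof (subst Ioi_eq_UN_Ioc, simp, intro sigma_sets.Union sigma_sets.Basic)
    fix n
    have "0 < max 0 c + 1 / real (Suc n)"
      by (rule add_nonneg_pos) auto
    then show "{max 0 c + 1 / real (Suc n)<..max 0 c + 1 / real (Suc n) + real n}
        \<in> (\<lambda>(a, b). {a<..b}) ` {(a, b). 0 < a \<and> a \<le> b}"
      by (intro image_eqI[where x="(max 0 c + 1 / real (Suc n), max 0 c + 1 / real (Suc n) + real n)"]) auto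
  qed
  finally show "{y \<in> space (stieltjes g). c < y} \<in> sets (stieltjes g)" .
qed

text \<open>The inverse of \<open>N\<close> on \<open>[0, \<infinity>)\<close>, continued by \<open>0\<close> to negative arguments. The continuation makes it
monotone, hence Borel measurable, on the whole line, and lets the Galois connections below hold
without a sign condition on \<open>u\<close>.\<close>
definition ninv :: "(real \<Rightarrow> real) \<Rightarrow> real \<Rightarrow> real" where
  "ninv N u = inv_into {0..} N (max 0 u)"

context
  fixes N :: "real \<Rightarrow> real"
  assumes yo: "young_orlicz N"
begin

lemma N_nonneg: "0 \<le> N u"
  using yo by (simp add: young_orlicz_def)

lemma N_continuous: "continuous_on A N"
  using yo by (auto simp: young_orlicz_def intro: continuous_on_subset)

lemma N_measurable [measurable]: "N \<in> borel_measurable borel"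
  by (intro borel_measurable_continuous_onI N_continuous)

lemma N_zero: "N 0 = 0"
proof -
  have "((\<lambda>u. N u / u * u) \<longlongrightarrow> 0 * 0) (at 0)"
    using yo by (intro tendsto_mult) (auto simp: young_orlicz_def)
  moreover have "eventually (\<lambda>u. N u / u * u = N u) (at 0)"
    by (simp add: eventually_at_filter)
  ultimately have "(N \<longlongrightarrow> 0) (at 0)"
    by (simp add: tendsto_cong)
  moreover have "(N \<longlongrightarrow> N 0) (at 0)"
    using N_continuous[of UNIV] by (simp add: continuous_on_def)
  ultimately show ?thesis
    using tendsto_unique trivial_limit_at by blast
qed

lemma N_less_iff: "0 \<le> s \<Longrightarrow> 0 \<le> t \<Longrightarrow> N s < N t \<longleftrightarrow> s < t"
  using yo by (intro strict_mono_on_less[of "{0..}"]) (auto simp: young_orlicz_def)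

lemma N_le_iff: "0 \<le> s \<Longrightarrow> 0 \<le> t \<Longrightarrow> N s \<le> N t \<longleftrightarrow> s \<le> t"
  using N_less_iff[of t s] by linarith

lemma N_pos: "0 < t \<Longrightarrow> 0 < N t"
  using N_less_iff[of 0 t] by (simp add: N_zero)

lemma ninv_nonneg: "0 \<le> ninv N u"
  and N_ninv: "0 \<le> u \<Longrightarrow> N (ninv N u) = u"
proof -
  have *: "v \<in> N ` {0..}" if "0 \<le> v" for v
  proof -
    have "eventually (\<lambda>t. v \<le> N t) at_top"
      using yo by (simp add: young_orlicz_def filterlim_at_top)
    with eventually_ge_at_top[of 0] have "eventually (\<lambda>t. 0 \<le> t \<and> v \<le> N t) at_top"
      by (rule eventually_conj)
    then obtain t where "0 \<le> t" "v \<le> N t"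
      using eventually_happens trivial_limit_at_top_linorder by blast
    moreover have "N 0 \<le> v" using that by (simp add: N_zero)
    ultimately obtain s where "0 \<le> s" "N s = v"
      using IVT'[of N 0 v t] N_continuous[of "{0..t}"] by blast
    then show ?thesis by auto
  qed
  show "0 \<le> ninv N u"
    using inv_into_into[OF *[of "max 0 u"]] by (simp add: ninv_def)
  show "0 \<le> u \<Longrightarrow> N (ninv N u) = u"
    using f_inv_into_f[OF *[of u]] by (simp add: ninv_def)
qed

lemma less_ninv_iff: "0 \<le> t \<Longrightarrow> t < ninv N u \<longleftrightarrow> N t < u"
proof (cases "0 \<le> u")
  case True
  then show "0 \<le> t \<Longrightarrow> t < ninv N u \<longleftrightarrow> N t < u"
    using N_less_iff[of t "ninv N u"] by (simp add: N_ninv ninv_nonneg)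
next
  case False
  then have "ninv N u = ninv N 0" by (simp add: ninv_def max_def)
  then have "N (ninv N u) = 0" by (simp add: N_ninv)
  then show "0 \<le> t \<Longrightarrow> t < ninv N u \<longleftrightarrow> N t < u"
    using N_less_iff[of t "ninv N u"] N_nonneg[of t] False ninv_nonneg[of u] by simp
qed

lemma ninv_le_iff: "0 \<le> t \<Longrightarrow> ninv N u \<le> t \<longleftrightarrow> u \<le> N t"
  using less_ninv_iff[of t u] by linarith

lemma le_ninv_iff: "0 < t \<Longrightarrow> t \<le> ninv N u \<longleftrightarrow> N t \<le> u"
proof (cases "0 \<le> u")
  case True
  then show "0 < t \<Longrightarrow> t \<le> ninv N u \<longleftrightarrow> N t \<le> u"
    using N_le_iff[of t "ninv N u"] by (simp add: N_ninv ninv_nonneg)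
next
  case False
  assume "0 < t"
  moreover have "ninv N u \<le> 0"
    using False by (simp add: ninv_le_iff N_zero)
  ultimately show "t \<le> ninv N u \<longleftrightarrow> N t \<le> u"
    using False N_pos[of t] by linarith
qed

lemma ninv_pos: "0 < u \<Longrightarrow> 0 < ninv N u"
  by (simp add: less_ninv_iff N_zero)

lemma ninv_measurable [measurable]: "ninv N \<in> borel_measurable borel"
proof (intro borel_measurable_mono monoI)
  fix u v :: real assume "u \<le> v"
  then show "ninv N u \<le> ninv N v"
    using ninv_le_iff[of "ninv N v" u] N_ninv[of v] ninv_nonneg[of v] N_nonneg[of "ninv N v"]
    by (cases "0 \<le> v") auto
qed

lemma recip_eq: "0 < t \<Longrightarrow> recip N t = ennreal (1 / N t)"
  unfolding recip_def using N_pos[of t] by (metis divide_ennreal ennreal_1 zero_le_one)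

lemma vimage_ninv_inverse:
  assumes "0 < a" "a \<le> b"
  shows "(\<lambda>s. ninv N (1 / s)) -` {a<..b} \<inter> {0<..} = {1 / N b..<1 / N a}"
proof (intro set_eqI)
  fix s :: real
  have N: "0 < N a" "0 < N b" "0 \<le> a" "0 \<le> b" using assms by (simp_all add: N_pos)
  have "s \<in> (\<lambda>s. ninv N (1 / s)) -` {a<..b} \<inter> {0<..} \<longleftrightarrow>
      0 < s \<and> N a < 1 / s \<and> 1 / s \<le> N b"
    using N by (auto simp: less_ninv_iff ninv_le_iff)
  also have "\<dots> \<longleftrightarrow> 0 < s \<and> s < 1 / N a \<and> 1 / N b \<le> s"
    using N by (intro conj_cong refl) (simp_all add: field_simps)
  also have "\<dots> \<longleftrightarrow> s \<in> {1 / N b..<1 / N a}"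
    using N less_le_trans[of 0 "1 / N b" s] by auto
  finally show "s \<in> (\<lambda>s. ninv N (1 / s)) -` {a<..b} \<inter> {0<..} \<longleftrightarrow>
      s \<in> {1 / N b..<1 / N a}" .
qed

lemma ninv_inverse_measurable:
  "(\<lambda>s. ninv N (1 / s)) \<in> measurable (restrict_space lborel {0<..}) (stieltjes g)"
proof (rule measurable_sigma_sets[OF sets_stieltjes])
  let ?G = "\<lambda>(a, b). {a<..b::real}" and ?I = "{(a, b). 0 < a \<and> a \<le> (b::real)}"
  let ?L = "restrict_space lborel {0<..} :: real measure"
  show "?G ` ?I \<subseteq> Pow {0<..}" by auto
  show "(\<lambda>s. ninv N (1 / s)) \<in> space ?L \<rightarrow> {0<..}"
    by (auto simp: space_restrict_space intro!: ninv_pos)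
  fix A assume "A \<in> ?G ` ?I"
  then obtain a b where A: "A = {a<..b}" "0 < a" "a \<le> b" by auto
  have eq: "(\<lambda>s. ninv N (1 / s)) -` A \<inter> space ?L = {1 / N b..<1 / N a}"
    using vimage_ninv_inverse[OF A(2,3)] by (simp add: A(1) space_restrict_space)
  have "{1 / N b..<1 / N a} \<subseteq> {0<..}"
    using vimage_ninv_inverse[OF A(2,3)] by blast
  then show "(\<lambda>s. ninv N (1 / s)) -` A \<inter> space ?L \<in> sets ?L"
    unfolding eq by (subst sets_restrict_space_iff) simp_all
qed

text \<open>The measure \<open>-d(1/N)\<close> is the image of Lebesgue measure under \<open>s \<mapsto> N\<inverse>(1/s)\<close>, the inverse of the decreasing
bijection \<open>1/N\<close> of \<open>(0, \<infinity>)\<close>. This image measure gives \<open>(a, b]\<close> the mass \<open>1/N(a) - 1/N(b)\<close>; in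
particular a measure with the prescribed values exists, and the intervals determine it. Its
\<open>\<sigma>\<close>-algebra is copied from the Stieltjes measure, so that the two can be equal as measures.\<close>
lemma stieltjes_recip_eq_distr:
  "stieltjes (recip N) =
    distr (restrict_space lborel {0<..}) (stieltjes (recip N)) (\<lambda>s. ninv N (1 / s))"
    (is "?S = ?D")
proof -
  let ?G = "\<lambda>(a, b). {a<..b::real}" and ?I = "{(a, b). 0 < a \<and> a \<le> (b::real)}"
  let ?L = "restrict_space lborel {0<..} :: real measure"
  have GI: "?G ` ?I \<subseteq> Pow {0<..}" by auto
  have D: "emeasure ?D {a<..b} = recip N a - recip N b" if "0 < a" "a \<le> b" for a b
  proof -
    have "{a<..b} \<in> sets ?S" unfolding sets_stieltjes using that by auto
    then have "emeasure ?D {a<..b} = emeasure ?L {1 / N b..<1 / N a}"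
      using vimage_ninv_inverse[OF that]
      by (simp add: emeasure_distr[OF ninv_inverse_measurable] space_restrict_space)
    also have "\<dots> = emeasure lborel {1 / N b..<1 / N a}"
      using vimage_ninv_inverse[OF that] by (intro emeasure_restrict_space) (simp, blast)
    also have "\<dots> = ennreal (1 / N a - 1 / N b)"
      using that N_pos[of a] N_le_iff[of a b] by (intro emeasure_lborel_Ico) (simp add: frac_le)
    also have "\<dots> = recip N a - recip N b"
      using that N_pos[of b] by (simp add: recip_eq ennreal_minus)
    finally show ?thesis .
  qed
  have S: "emeasure ?S {a<..b} = recip N a - recip N b" if "0 < a" "a \<le> b" for a b
  proof (rule emeasure_extend_measure_Pair[OF stieltjes_def])
    show "positive (sets ?S) (emeasure ?D)" "countably_additive (sets ?S) (emeasure ?D)"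
      using emeasure_positive[of ?D] emeasure_countably_additive[of ?D] by simp_all
  qed (use that D in auto)
  show ?thesis
  proof (rule measure_eqI_generator_eq[where E="?G ` ?I" and \<Omega>="{0<..}" 
      and A="\<lambda>n. {1 / real (Suc n)<..1 / real (Suc n) + real n}"])
    show "Int_stable (?G ` ?I)"
    proof (rule Int_stableI, safe)
      fix a b c d :: real
      assume *: "0 < a" "a \<le> b" "0 < c" "c \<le> d"
      show "{a<..b} \<inter> {c<..d} \<in> ?G ` ?I"
        using * by (intro image_eqI[where x="(max a c, max (max a c) (min b d))"]) auto
    qed
    show "(\<Union>n. {1 / real (Suc n)<..1 / real (Suc n) + real n}) = {0<..}"
      using Ioi_eq_UN_Ioc[of 0] by simp
    show "emeasure ?S {1 / real (Suc n)<..1 / real (Suc n) + real n} \<noteq> \<infinity>" for n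
      using S[of "1 / real (Suc n)" "1 / real (Suc n) + real n"]
      by (simp add: recip_eq del: of_nat_Suc)
  qed (use GI S D in \<open>auto simp: sets_stieltjes\<close>)
qed

lemma nn_integral_stieltjes_recip:
  assumes f: "f \<in> borel_measurable (stieltjes (recip N))"
  shows "(\<integral>\<^sup>+ y. f y \<partial>stieltjes (recip N)) = (\<integral>\<^sup>+ s\<in>{0<..}. f (ninv N (1 / s)) \<partial>lborel)"
  by (subst stieltjes_recip_eq_distr)
    (simp add: nn_integral_distr[OF ninv_inverse_measurable] f nn_integral_restrict_space)

section \<open>Modulars as integrals of tails\<close>

lemma Q_integrand_measurable:
  "(\<lambda>y. ennreal (N (y / k)) * indicator {c<..} y) \<in> borel_measurable (stieltjes g)"
  by (rule measurable_compose[OF ident_measurable_stieltjes]) measurable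

text \<open>Under the substitution \<open>y = N\<inverse>(1/s)\<close> the condition \<open>y > y\<^sub>0\<close> becomes \<open>s < \<mu>(X)\<close>, and \<open>N (y/k) \<ge> u\<close>
becomes \<open>s \<le> 1 / N (k N\<inverse>(u))\<close>. The superlevel sets of the integrand are therefore initial
intervals whose length is the minimum of these two bounds, which is a value of \<open>V\<close>.\<close>
lemma Q_eq_integral_V:
  assumes m: "emeasure M (space M) \<noteq> 0" and k: "0 < k"
  shows "Q M N k = (\<integral>\<^sup>+ u\<in>{0<..}. V M N (k * ninv N u) \<partial>lborel)"
proof -
  let ?m = "emeasure M (space M)"
  define G where "G s = (if 0 < s \<and> ennreal s < ?m then N (ninv N (1 / s) / k) else 0)" for s
  have G_meas [measurable]: "G \<in> borel_measurable borel"
    unfolding G_def by measurable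
  have y0: "y0 M N = ninv N (enn2real (1 / ?m))"
    by (simp add: y0_def ninv_def)
  have y0_less: "y0 M N < ninv N (1 / s) \<longleftrightarrow> ennreal s < ?m" if "0 < s" for s
  proof -
    have "y0 M N < ninv N (1 / s) \<longleftrightarrow> enn2real (1 / ?m) < 1 / s"
      unfolding y0 by (simp add: less_ninv_iff ninv_nonneg N_ninv)
    also have "\<dots> \<longleftrightarrow> ennreal s < ?m"
    proof (cases ?m)
      case (real r)
      with m have "0 < r" by (cases "r = 0") auto
      then have "enn2real (1 / ?m) = 1 / r"
        using divide_ennreal[of 1 r] real by simp
      show ?thesis
        unfolding \<open>enn2real (1 / ?m) = 1 / r\<close> using \<open>0 < r\<close> that real by (simp add: ennreal_less_iff field_simps)
    qed (use that in simp)
    finally show ?thesis .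
  qed
  have "Q M N k = (\<integral>\<^sup>+ s\<in>{0<..}. ennreal (N (ninv N (1 / s) / k)) *
      indicator {y0 M N<..} (ninv N (1 / s)) \<partial>lborel)"
    unfolding Q_def by (rule nn_integral_stieltjes_recip[OF Q_integrand_measurable])
  also have "\<dots> = (\<integral>\<^sup>+ s. ennreal (G s) \<partial>lborel)"
    by (intro nn_integral_cong) (auto simp: G_def indicator_def y0_less)
  also have "\<dots> = (\<integral>\<^sup>+ u\<in>{0<..}. emeasure lborel {s \<in> space lborel. u \<le> G s} \<partial>lborel)"
    by (rule layer_cake) (simp_all add: sigma_finite_lborel)
  also have "\<dots> = (\<integral>\<^sup>+ u\<in>{0<..}. V M N (k * ninv N u) \<partial>lborel)"
  proof (rule set_nn_integral_cong)
    fix u :: real assume "u \<in> space lborel \<inter> {0<..}"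
    then have u: "0 < u" by simp
    define t where "t = k * ninv N u"
    have t: "0 < t" using k u by (simp add: t_def ninv_pos)
    have "u \<le> N (h / k) \<longleftrightarrow> t \<le> h" if "0 \<le> h" for h
      using k that ninv_le_iff[of "h / k" u] by (simp add: t_def field_simps)
    then have "u \<le> G s \<longleftrightarrow> 0 < s \<and> s \<le> 1 / N t \<and> ennreal s < ?m" for s
      using u N_pos[OF t] by (auto simp: G_def ninv_nonneg le_ninv_iff[OF t] field_simps)
    then have "{s \<in> space lborel. u \<le> G s} = {s. 0 < s \<and> s \<le> 1 / N t \<and> ennreal s < ?m}"
      by simp
    also have "emeasure lborel \<dots> = V M N t"
    proof (cases ?m)
      case top
      then have "{s. 0 < s \<and> s \<le> 1 / N t \<and> ennreal s < ?m} = {0<..1 / N t}"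
        by auto
      then show ?thesis
        using N_pos[OF t] by (simp add: V_def recip_eq[OF t] top)
    next
      case (real r)
      show ?thesis
      proof (cases "1 / N t < r")
        case True
        then have "{s. 0 < s \<and> s \<le> 1 / N t \<and> ennreal s < ?m} = {0<..1 / N t}"
          using real by (auto simp: ennreal_less_iff)
        then show ?thesis
          using N_pos[OF t] True real by (simp add: V_def recip_eq[OF t] min_def)
      next
        case False
        then have "{s. 0 < s \<and> s \<le> 1 / N t \<and> ennreal s < ?m} = {0<..<r}"
          using real by (auto simp: ennreal_less_iff)
        then show ?thesis
          using N_pos[OF t] False real by (simp add: V_def recip_eq[OF t] min_def)
      qed
    qed
    finally show "emeasure lborel {s \<in> space lborel. u \<le> G s} = V M N (k * ninv N u)"
      by (simp add: t_def)
  qed simp_all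
  finally show ?thesis .
qed

lemma modular_eq_integral_tail:
  assumes "sigma_finite_measure M" and [measurable]: "f \<in> borel_measurable M" and c: "0 < c"
  shows "(\<integral>\<^sup>+ x. ennreal (N (\<bar>f x\<bar> / c)) \<partial>M) =
    (\<integral>\<^sup>+ u\<in>{0<..}. tail M f (c * ninv N u) \<partial>lborel)"
proof -
  have "(\<integral>\<^sup>+ x. ennreal (N (\<bar>f x\<bar> / c)) \<partial>M) =
      (\<integral>\<^sup>+ u\<in>{0<..}. emeasure M {x \<in> space M. u \<le> N (\<bar>f x\<bar> / c)} \<partial>lborel)"
    by (rule layer_cake) (simp_all add: assms)
  also have "\<dots> = (\<integral>\<^sup>+ u\<in>{0<..}. tail M f (c * ninv N u) \<partial>lborel)"
  proof (rule set_nn_integral_cong)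
    fix u :: real assume "u \<in> space lborel \<inter> {0<..}"
    have "u \<le> N (\<bar>f x\<bar> / c) \<longleftrightarrow> c * ninv N u \<le> \<bar>f x\<bar>" for x
      using c ninv_le_iff[of "\<bar>f x\<bar> / c" u] by (simp add: field_simps)
    then show "emeasure M {x \<in> space M. u \<le> N (\<bar>f x\<bar> / c)} = tail M f (c * ninv N u)"
      by (simp add: tail_def)
  qed simp_all
  finally show ?thesis .
qed

text \<open>Convexity and \<open>N 0 = 0\<close> give \<open>N (y/l) \<le> (k/l) N (y/k)\<close>. Hence \<open>Q\<close> exceeds \<open>1\<close> to the left of a point
where it equals \<open>1\<close>, also when it is infinite there.\<close>
lemma Q_contraction:
  assumes "0 < k" "k \<le> l"
  shows "Q M N l \<le> ennreal (k / l) * Q M N k"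
proof -
  have "N (y / l) \<le> k / l * N (y / k)" for y
  proof -
    have "convex_on UNIV N" using yo by (simp add: young_orlicz_def)
    from convex_onD[OF this, of "k / l" 0 "y / k"] show ?thesis
      using assms by (simp add: N_zero)
  qed
  then have "ennreal (N (y / l)) * indicator A y \<le>
      ennreal (k / l) * (ennreal (N (y / k)) * indicator A y)" for y A
    using assms by (auto simp: indicator_def N_nonneg simp flip: ennreal_mult intro!: ennreal_leI)
  then have "Q M N l \<le> (\<integral>\<^sup>+ y. ennreal (k / l) * (ennreal (N (y / k)) *
      indicator {y0 M N<..} y) \<partial>stieltjes (recip N))"
    unfolding Q_def by (intro nn_integral_mono)
  also have "\<dots> = ennreal (k / l) * Q M N k"
    unfolding Q_def by (rule nn_integral_cmult[OF Q_integrand_measurable])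
  finally show ?thesis .
qed

text \<open>By the two layer-cake formulas both sides are integrals over the same levels \<open>u\<close>, of
\<open>tail M f (k K N\<inverse>(u))\<close> and of \<open>V (k N\<inverse>(u))\<close>; the tail bound at \<open>t = k K N\<inverse>(u)\<close> compares them
pointwise.\<close>
lemma modular_le_Q:
  assumes M: "sigma_finite_measure M" "emeasure M (space M) \<noteq> 0"
    and f: "f \<in> borel_measurable M" and pos: "0 < k" "0 < K"
    and tail: "\<And>t. 0 < t \<Longrightarrow> tail M f t \<le> V M N (t / K)"
  shows "(\<integral>\<^sup>+ x. ennreal (N (\<bar>f x\<bar> / (k * K))) \<partial>M) \<le> Q M N k"
proof -
  have "(\<integral>\<^sup>+ x. ennreal (N (\<bar>f x\<bar> / (k * K))) \<partial>M) =
      (\<integral>\<^sup>+ u\<in>{0<..}. tail M f (k * K * ninv N u) \<partial>lborel)"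
    using pos by (intro modular_eq_integral_tail[OF M(1) f]) simp
  also have "\<dots> \<le> (\<integral>\<^sup>+ u\<in>{0<..}. V M N (k * ninv N u) \<partial>lborel)"
  proof (rule nn_integral_mono)
    fix u :: real
    show "tail M f (k * K * ninv N u) * indicator {0<..} u \<le> V M N (k * ninv N u) * indicator {0<..} u"
      using tail[of "k * K * ninv N u"] pos ninv_pos[of u]
      by (cases "0 < u") (simp_all add: field_simps)
  qed
  also have "\<dots> = Q M N k"
    by (rule Q_eq_integral_V[OF M(2) pos(1), symmetric])
  finally show ?thesis .
qed

lemma strong_norm_le_weak_norm:
  assumes M: "sigma_finite_measure M" "emeasure M (space M) \<noteq> 0"
    and f: "f \<in> borel_measurable M" and k: "0 < k" "Q M N k \<le> 1"
  shows "strong_norm M N f \<le> ennreal k * weak_norm M N f"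
proof -
  define W where "W = {ennreal K | K. 0 < K \<and> (\<forall>t>0. tail M f t \<le> V M N (t / K))}"
  have W: "weak_norm M N f = Inf W" by (simp add: weak_norm_def W_def)
  have "strong_norm M N f \<le> ennreal k * w" if w: "w \<in> W" for w
  proof -
    obtain K where K: "w = ennreal K" "0 < K" "\<forall>t>0. tail M f t \<le> V M N (t / K)"
      using w unfolding W_def by blast
    have "(\<integral>\<^sup>+ x. ennreal (N (\<bar>f x\<bar> / (k * K))) \<partial>M) \<le> 1"
      using modular_le_Q[OF M f k(1) K(2)] K(3) k(2) order_trans by blast
    then have "strong_norm M N f \<le> ennreal (k * K)"
      unfolding strong_norm_def using k K by (intro Inf_lower) (auto intro!: exI[of _ "k * K"])
    then show ?thesis using k K by (simp add: ennreal_mult)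
  qed
  then have "strong_norm M N f / ennreal k \<le> w" if "w \<in> W" for w
    using that k by (intro divide_le_posI_ennreal) (auto simp: mult.commute)
  then have "strong_norm M N f / ennreal k \<le> Inf W" by (rule Inf_greatest)
  then have "ennreal k * (strong_norm M N f / ennreal k) \<le> ennreal k * weak_norm M N f"
    unfolding W by (rule mult_left_mono) simp
  moreover have "ennreal k * (strong_norm M N f / ennreal k) = strong_norm M N f"
    using k mult_divide_eq_ennreal[of "ennreal k" "strong_norm M N f"]
    by (simp add: ennreal_times_divide mult.commute)
  ultimately show ?thesis by simp
qed

section \<open>Extremal functions and the sharp constant\<close>

text \<open>The extremal function of the weak unit ball is \<open>N\<inverse>(1/U)\<close>, where \<open>U\<close> is distributed according to
Lebesgue measure on \<open>(0, \<mu>(X))\<close>: it is at least \<open>t\<close> exactly where \<open>0 < U \<le> 1 / N t\<close>.\<close>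
lemma tail_extremal_exists:
  assumes "atomless M"
  obtains f where "f \<in> borel_measurable M" "\<And>t. 0 < t \<Longrightarrow> tail M f t = V M N t"
proof -
  obtain U where [measurable]: "U \<in> borel_measurable M" and
    U: "\<And>s. 0 \<le> s \<Longrightarrow> emeasure M {x \<in> space M. U x \<le> ennreal s} = min (emeasure M (space M)) (ennreal s)"
    using atomless_uniform_function[OF assms] by blast
  \<comment> \<open>Where \<open>U = \<infinity>\<close>, the conventions \<open>enn2real \<infinity> = 0\<close> and \<open>1 / 0 = 0\<close> give \<open>f = 0\<close>, as desired; where
    \<open>U = 0\<close> they also give \<open>0\<close>, on a null set.\<close>
  define f where "f x = ninv N (1 / enn2real (U x))" for x
  have "f \<in> borel_measurable M" unfolding f_def by measurable
  moreover have "tail M f t = V M N t" if t: "0 < t" for t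
  proof -
    define r where "r = 1 / N t"
    have r: "0 < r" using N_pos[OF t] by (simp add: r_def)
    have "t \<le> \<bar>f x\<bar> \<longleftrightarrow> U x \<le> ennreal r \<and> \<not> U x \<le> ennreal 0" for x
    proof -
      have "t \<le> \<bar>f x\<bar> \<longleftrightarrow> N t \<le> 1 / enn2real (U x)"
        using le_ninv_iff[OF t] ninv_nonneg by (simp add: f_def)
      also have "\<dots> \<longleftrightarrow> U x \<le> ennreal r \<and> \<not> U x \<le> ennreal 0"
      proof (cases "U x")
        case (real u)
        then show ?thesis
          using N_pos[OF t] by (cases "u = 0") (auto simp: r_def field_simps)
      next
        case top
        then show ?thesis using N_pos[OF t] by (simp add: top_unique)
      qed
      finally show ?thesis .
    qed
    then have "tail M f t = emeasure M ({x \<in> space M. U x \<le> ennreal r} - {x \<in> space M. U x \<le> ennreal 0})"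
      unfolding tail_def by (intro arg_cong[of _ _ "emeasure M"]) auto
    also have "\<dots> = emeasure M {x \<in> space M. U x \<le> ennreal r} - emeasure M {x \<in> space M. U x \<le> ennreal 0}"
      using U[of 0] r by (intro emeasure_Diff) (auto intro: order_trans)
    also have "\<dots> = V M N t"
      using U[of 0] U[of r] r t by (simp add: V_def recip_eq r_def)
    finally show ?thesis .
  qed
  ultimately show thesis by (rule that)
qed

end

theorem theorem3p1:
  fixes M :: "'a measure" and N :: "real \<Rightarrow> real" and k0 :: real
  assumes "sigma_finite_measure M" and "atomless M" and "emeasure M (space M) \<noteq> 0"
    and "young_orlicz N"
    and "J M N < \<infinity>"
    and "1 \<le> k0" and "Q M N k0 = 1"
  shows "(\<forall>f\<in>weak_orlicz M N. strong_norm M N f \<le> ennreal k0 * weak_norm M N f) \<and>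
    Y M N = ennreal k0"
proof
  note M = assms(1,3) and yo = assms(4)
  show upper: "\<forall>f\<in>weak_orlicz M N. strong_norm M N f \<le> ennreal k0 * weak_norm M N f"
    using strong_norm_le_weak_norm[OF yo M, of _ k0] assms(6,7) by (simp add: weak_orlicz_def)
  show "Y M N = ennreal k0"
  proof (rule antisym)
    have "strong_norm M N f / weak_norm M N f \<le> ennreal k0" if f: "f \<in> weak_orlicz M N" for f
    proof (cases "weak_norm M N f = 0")
      case True
      then have "strong_norm M N f = 0" using upper f by fastforce
      then show ?thesis by simp
    next
      case False
      moreover have "weak_norm M N f < top" using f by (simp add: weak_orlicz_def)
      ultimately show ?thesis
        using upper f by (simp add: divide_le_posI_ennreal zero_less_iff_neq_zero mult.commute)
    qed
    then show "Y M N \<le> ennreal k0" unfolding Y_def by (intro SUP_least) auto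
    \<comment> \<open>For the extremal function the modular at scale \<open>k\<close> equals \<open>Q k\<close>, so its strong norm is at
      least \<open>k0\<close>, while its weak norm is at most \<open>1\<close>.\<close>
    obtain f where f: "f \<in> borel_measurable M" and tail: "\<And>t. 0 < t \<Longrightarrow> tail M f t = V M N t"
      using tail_extremal_exists[OF yo assms(2)] by blast
    have weak: "weak_norm M N f \<le> 1"
      unfolding weak_norm_def by (rule Inf_lower) (auto intro!: exI[of _ 1] simp: tail)
    then have f_in: "f \<in> weak_orlicz M N"
      using f by (auto simp: weak_orlicz_def intro: le_less_trans)
    have strong: "ennreal k0 \<le> strong_norm M N f"
      unfolding strong_norm_def
    proof (rule Inf_greatest, safe)
      fix k :: real assume k: "0 < k" and le: "(\<integral>\<^sup>+ x. ennreal (N (\<bar>f x\<bar> / k)) \<partial>M) \<le> 1"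
      have Qk: "(\<integral>\<^sup>+ x. ennreal (N (\<bar>f x\<bar> / k)) \<partial>M) = Q M N k"
        unfolding modular_eq_integral_tail[OF yo M(1) f k] Q_eq_integral_V[OF yo M(2) k]
        by (rule set_nn_integral_cong) (use k ninv_pos[OF yo] tail in auto)
      show "ennreal k0 \<le> ennreal k"
      proof (rule ccontr)
        assume "\<not> ennreal k0 \<le> ennreal k"
        then have lt: "k < k0" using k by (meson ennreal_leI not_le)
        then have "1 \<le> ennreal (k / k0) * Q M N k"
          using Q_contraction[OF yo k, of k0 M] assms(7) by simp
        also have "\<dots> \<le> ennreal (k / k0) * 1"
          using le Qk by (intro mult_left_mono) auto
        finally have "ennreal 1 \<le> ennreal (k / k0)" by simp
        then have "1 \<le> k / k0" using k lt by (subst (asm) ennreal_le_iff) auto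
        then show False using k lt by simp
      qed
    qed
    have "\<not> (AE x in M. f x = 0)"
    proof
      assume "AE x in M. f x = 0"
      then have "(\<integral>\<^sup>+ x. ennreal (N (\<bar>f x\<bar> / (k0 / 2))) \<partial>M) = (\<integral>\<^sup>+ x. 0 \<partial>M)"
        by (intro nn_integral_cong_AE) (auto simp: N_zero[OF yo] elim!: eventually_mono)
      then have "strong_norm M N f \<le> ennreal (k0 / 2)"
        unfolding strong_norm_def using assms(6) by (intro Inf_lower) (auto intro!: exI[of _ "k0 / 2"])
      with strong have "ennreal k0 \<le> ennreal (k0 / 2)" by (rule order_trans)
      with assms(6) show False by simp
    qed
    then have "strong_norm M N f / weak_norm M N f \<le> Y M N"
      unfolding Y_def using f_in by (intro SUP_upper) auto
    moreover have "strong_norm M N f \<le> strong_norm M N f / weak_norm M N f"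
    proof (cases "weak_norm M N f = 0")
      case True
      have "strong_norm M N f \<noteq> 0" using strong assms(6) by auto
      with True show ?thesis by simp
    next
      case False
      moreover have "weak_norm M N f \<noteq> top" using weak by (auto simp: top_unique)
      ultimately have "strong_norm M N f = strong_norm M N f / weak_norm M N f * weak_norm M N f"
        using mult_divide_eq_ennreal[of "weak_norm M N f" "strong_norm M N f"]
        by (simp add: ennreal_times_divide mult.commute)
      also have "\<dots> \<le> strong_norm M N f / weak_norm M N f * 1"
        using weak by (rule mult_left_mono) simp
      finally show ?thesis by simp
    qed
    ultimately show "ennreal k0 \<le> Y M N" using strong by (meson order_trans)
  qed
qed

end
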